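(* Let $\nu$ be a length distribution function with normalizing constant $Z_\nu$. Then in the $\nu$-RSA process, for all $L\ge0$, $$\Big(\int_0^L Z_\nu(t)\,dt\Big)\,\mathbb{E}[S_L]=2\int_0^L\mathbb{E}[S_t]\,Z_\nu(L-t)\,dt .$$
   Context: A length distribution function (ldf) is a nonnegative function $\nu:[0,\infty)\to[0,\infty)$, integrable on bounded intervals, with $\nu(\ell)=0$ for $\ell\in[0,1)$ and $\int_1^\ell\nu(t)\,dt>0$ for all $\ell>1$. Its normalizing constant is $Z_\nu(L)=\int_0^L\nu(\ell)\,d\ell$. $\nu$-RSA process on $[0,L]$ ($L>1$): start with $I_0=[0,L]$. At each time $T=1,2,\dots$, independently of the past, sample $b$ uniformly from $[0,L]$ and, independently, a length $\ell\in[1,L]$ with density $\nu(\ell)/Z_\nu(L)$. If $(b,b+\ell)\subseteq I_{T-1}$, the segment is parked and $I_T=I_{T-1}\setminus(b,b+\ell)$; otherwise $I_T=I_{T-1}$. The empty space at saturation is $S_L=\lim_{T\to\infty}\lambda(I_T)$, where $\lambda$ is Lebesgue measure. For $0\le L\le 1$ no segment is parked and $S_L=L$. *)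

theory Defs
  imports "HOL-Probability.Probability"
begin

text \<open>
  Integrability is with respect to Lebesgue measure on the Lebesgue-measurable sets, so that a
  length distribution function need not be Borel measurable. The values of \<open>\<nu>\<close> at negative
  arguments play no role.
\<close>

definition ldf :: "(real \<Rightarrow> real) \<Rightarrow> bool" where
  "ldf \<nu> \<longleftrightarrow>
     (\<forall>l\<ge>0. \<nu> l \<ge> 0) \<and>
     (\<forall>a b. 0 \<le> a \<and> a \<le> b \<longrightarrow> set_integrable lebesgue {a..b} \<nu>) \<and>
     (\<forall>l\<in>{0..<1}. \<nu> l = 0) \<and>
     (\<forall>l>1. (LINT t:{1..l}|lebesgue. \<nu> t) > 0)"

definition Z :: "(real \<Rightarrow> real) \<Rightarrow> real \<Rightarrow> real" where
  "Z \<nu> L = (LINT t:{0..L}|lebesgue. \<nu> t)"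

definition length_law :: "(real \<Rightarrow> real) \<Rightarrow> real \<Rightarrow> real measure" where
  "length_law \<nu> L = density lebesgue (\<lambda>l. ennreal (indicator {1..L} l * (\<nu> l / Z \<nu> L)))"

definition attempt_law :: "(real \<Rightarrow> real) \<Rightarrow> real \<Rightarrow> (real \<times> real) measure" where
  "attempt_law \<nu> L = uniform_measure lborel {0..L} \<Otimes>\<^sub>M length_law \<nu> L"

text \<open>
  The sample space of the process: the pair \<open>\<omega> T\<close> is the attempt \<open>(b, \<ell>)\<close> made at time \<open>T + 1\<close>.
  It is a probability space only for \<open>L > 1\<close>.
\<close>

definition rsa_law :: "(real \<Rightarrow> real) \<Rightarrow> real \<Rightarrow> (nat \<Rightarrow> real \<times> real) measure" where
  "rsa_law \<nu> L = (\<Pi>\<^sub>M T\<in>UNIV. attempt_law \<nu> L)"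

fun vacant :: "real \<Rightarrow> (nat \<Rightarrow> real \<times> real) \<Rightarrow> nat \<Rightarrow> real set" where
  "vacant L \<omega> 0 = {0..L}"
| "vacant L \<omega> (Suc T) =
     (let (b, l) = \<omega> T; I = vacant L \<omega> T
      in if {b<..<b + l} \<subseteq> I then I - {b<..<b + l} else I)"

definition empty_space :: "real \<Rightarrow> (nat \<Rightarrow> real \<times> real) \<Rightarrow> real" where
  "empty_space L \<omega> = lim (\<lambda>T. measure lborel (vacant L \<omega> T))"

text \<open>For \<open>L \<le> 1\<close> no process is run and the empty space is the constant \<open>L\<close>.\<close>

definition expected_empty_space :: "(real \<Rightarrow> real) \<Rightarrow> real \<Rightarrow> real" where
  "expected_empty_space \<nu> L =
     (if L \<le> 1 then L else (LINT \<omega>|rsa_law \<nu> L. empty_space L \<omega>))"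

end

theory Submission
  imports Defs
begin

text \<open>
  Run the attempts of the process on \<open>[0, L]\<close> and watch only an interval \<open>[a, b] \<subseteq> [0, L]\<close>.
  A first attempt that fits splits it into two intervals that evolve under the same attempts
  and do not interact, so the expected vacant length after \<open>T\<close> attempts depends only on
  \<open>x = b - a\<close> and satisfies, with \<open>M = L Z(L)\<close>,
  \<open>g\<^bsub>T + 1\<^esub>(x) = g\<^bsub>T\<^esub>(x) + (2 \<integral>\<^bsub>[0, x]\<^esub> g\<^bsub>T\<^esub>(s) Z(x - s) ds - g\<^bsub>T\<^esub>(x) \<integral>\<^bsub>[0, x]\<^esub> Z) / M\<close>.
  The decreasing limit \<open>h\<close> therefore satisfies \<open>h(x) \<integral>\<^bsub>[0, x]\<^esub> Z = 2 \<integral>\<^bsub>[0, x]\<^esub> h(s) Z(x - s) ds\<close>.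
  As \<open>Z\<close> vanishes on \<open>[0, 1]\<close>, this equation determines \<open>h\<close> on \<open>[0, n + 1]\<close> from its values on
  \<open>[0, n]\<close>, and \<open>h(x) = x\<close> for \<open>x \<le> 1\<close>. Hence \<open>h\<close> does not depend on \<open>L\<close>, and
  \<open>h(x)\<close> is the expected empty space of the process on \<open>[0, x]\<close>: no time change relating the
  processes on intervals of different length is needed.
\<close>

section \<open>Deterministic evolution of the vacant set\<close>

fun park :: "real \<times> real \<Rightarrow> real set \<Rightarrow> real set" where
  "park (b, l) I = (if {b<..<b + l} \<subseteq> I then I - {b<..<b + l} else I)"

text \<open>The initial set is arbitrary so that the process can be restarted from the two intervals
  that a first parked segment leaves.\<close>

primrec vacant_from :: "real set \<Rightarrow> (nat \<Rightarrow> real \<times> real) \<Rightarrow> nat \<Rightarrow> real set" where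
  "vacant_from I \<omega> 0 = I"
| "vacant_from I \<omega> (Suc T) = park (\<omega> T) (vacant_from I \<omega> T)"

lemma vacant_eq_vacant_from: "vacant L \<omega> T = vacant_from {0..L} \<omega> T"
  by (induction T) (auto simp: Let_def split: prod.splits)

lemma vacant_from_Suc_shift:
  "vacant_from I \<omega> (Suc T) = vacant_from (park (\<omega> 0) I) (\<lambda>i. \<omega> (Suc i)) T"
  by (induction T) auto

lemma park_subset: "park p I \<subseteq> I"
  by (cases p) auto

lemma vacant_from_subset: "vacant_from I \<omega> T \<subseteq> I"
proof (induction T)
  case (Suc T)
  then show ?case using park_subset[of "\<omega> T" "vacant_from I \<omega> T"] by simp
qed simp

lemma vacant_from_measurable [measurable]:
  "I \<in> sets borel \<Longrightarrow> vacant_from I \<omega> T \<in> sets borel"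
proof (induction T)
  case (Suc T)
  then show ?case by (cases "\<omega> T") auto
qed auto

lemma vacant_from_fmeasurable: "vacant_from {a..b} \<omega> T \<in> fmeasurable lborel"
  using fmeasurable_cbox[of a b] vacant_from_subset[of "{a..b}" \<omega> T]
  by (auto intro: fmeasurableI2[of "{a..b}"])

text \<open>A segment is connected: if it lies in \<open>U \<union> V\<close> and meets both sets,
  it contains the midpoint of the gap between \<open>c\<close> and \<open>d\<close>, which is in
  neither. Hence parking acts on at most one side and ignores the other.\<close>

lemma park_Un:
  assumes "U \<subseteq> {..c}" "V \<subseteq> {d..}" "c < d"
  shows "park p (U \<union> V) = park p U \<union> park p V"
proof (cases p)
  case (Pair b l)
  have disj: "U \<inter> V = {}" using assms by fastforce
  have mid: "(c + d) / 2 \<notin> U \<union> V"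
  proof -
    have "c < (c + d) / 2" "(c + d) / 2 < d" using assms(3) by auto
    then show ?thesis using assms(1,2) by fastforce
  qed
  have split: "{b<..<b + l} \<subseteq> U \<or> {b<..<b + l} \<subseteq> V" if sub: "{b<..<b + l} \<subseteq> U \<union> V"
  proof (rule ccontr)
    assume "\<not> ?thesis"
    then obtain u v where u: "u \<in> {b<..<b + l}" "u \<in> U" and v: "v \<in> {b<..<b + l}" "v \<in> V"
      using sub by blast
    have "u \<le> c" "d \<le> v" using u v assms(1,2) by auto
    then have "(c + d) / 2 \<in> {b<..<b + l}"
      using u(1) v(1) assms(3) by auto
    then show False using sub mid by blast
  qed
  show ?thesis
    unfolding Pair park.simps using split disj by (auto; blast)
qed

lemma vacant_from_Un:
  assumes "U \<subseteq> {..c}" "V \<subseteq> {d..}" "c < d"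
  shows "vacant_from (U \<union> V) \<omega> T = vacant_from U \<omega> T \<union> vacant_from V \<omega> T"
proof (induction T)
  case (Suc T)
  then show ?case
    using park_Un[of "vacant_from U \<omega> T" c "vacant_from V \<omega> T" d] assms
      vacant_from_subset[of U \<omega> T] vacant_from_subset[of V \<omega> T] by auto
qed auto

text \<open>
  The recursion is on the first attempt, whereas \<^const>\<open>vacant_from\<close> recurses on the last one.
  The condition \<open>0 < l\<close> covers the junk attempts with \<open>l \<le> 0\<close>: their segment is empty, so
  parking it changes nothing.
\<close>

primrec vacant_length :: "nat \<Rightarrow> real \<Rightarrow> real \<Rightarrow> (nat \<Rightarrow> real \<times> real) \<Rightarrow> real" where
  "vacant_length 0 a b \<omega> = b - a"
| "vacant_length (Suc T) a b \<omega> =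
     (if 0 < snd (\<omega> 0) \<and> a \<le> fst (\<omega> 0) \<and> fst (\<omega> 0) + snd (\<omega> 0) \<le> b
      then vacant_length T a (fst (\<omega> 0)) (\<lambda>i. \<omega> (Suc i)) +
           vacant_length T (fst (\<omega> 0) + snd (\<omega> 0)) b (\<lambda>i. \<omega> (Suc i))
      else vacant_length T a b (\<lambda>i. \<omega> (Suc i)))"

text \<open>Peel off the first attempt. If it fits, it leaves two closed intervals at distance
  \<open>l > 0\<close>, which evolve separately by \<open>vacant_from_Un\<close>; otherwise it
  leaves \<open>{a..b}\<close> unchanged.\<close>

lemma measure_vacant_from:
  "a \<le> b \<Longrightarrow> measure lborel (vacant_from {a..b} \<omega> T) = vacant_length T a b \<omega>"
proof (induction T arbitrary: a b \<omega>)
  case (Suc T)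
  obtain s l where sl: "\<omega> 0 = (s, l)" by (cases "\<omega> 0")
  let ?\<omega> = "\<lambda>i. \<omega> (Suc i)"
  show ?case
  proof (cases "0 < l \<and> a \<le> s \<and> s + l \<le> b")
    case True
    then have "park (\<omega> 0) {a..b} = {a..s} \<union> {s + l..b}"
      unfolding sl park.simps by (auto simp: greaterThanLessThan_subseteq_atLeastAtMost_iff)
    then have "vacant_from {a..b} \<omega> (Suc T) = vacant_from {a..s} ?\<omega> T \<union> vacant_from {s + l..b} ?\<omega> T"
      unfolding vacant_from_Suc_shift using True vacant_from_Un[of "{a..s}" s "{s + l..b}" "s + l"] by auto
    moreover have "vacant_from {a..s} ?\<omega> T \<inter> vacant_from {s + l..b} ?\<omega> T = {}"
      using vacant_from_subset[of "{a..s}" ?\<omega> T] vacant_from_subset[of "{s + l..b}" ?\<omega> T] True by fastforce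
    ultimately have "measure lborel (vacant_from {a..b} \<omega> (Suc T)) =
      measure lborel (vacant_from {a..s} ?\<omega> T) + measure lborel (vacant_from {s + l..b} ?\<omega> T)"
      by (simp add: measure_Un3 vacant_from_fmeasurable)
    then show ?thesis using True Suc.IH[of a s ?\<omega>] Suc.IH[of "s + l" b ?\<omega>] by (simp add: sl)
  next
    case False
    then have "park (\<omega> 0) {a..b} = {a..b}"
      unfolding sl park.simps by (auto simp: greaterThanLessThan_subseteq_atLeastAtMost_iff)
    then have "measure lborel (vacant_from {a..b} \<omega> (Suc T)) = measure lborel (vacant_from {a..b} ?\<omega> T)"
      by (simp only: vacant_from_Suc_shift)
    also have "\<dots> = vacant_length T a b ?\<omega>"
      by (rule Suc.IH[OF Suc.prems])
    also have "\<dots> = vacant_length (Suc T) a b \<omega>"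
      using False by (auto simp: sl)
    finally show ?thesis .
  qed
qed auto

text \<open>Monotonicity in \<open>T\<close> concerns the last attempt, which the recursion of
  \<open>vacant_length\<close> does not expose; it is read off from the vacant sets, which can only
  shrink.\<close>

lemma vacant_length_bounds:
  assumes "a \<le> b"
  shows "0 \<le> vacant_length T a b \<omega>" "vacant_length T a b \<omega> \<le> b - a"
    "vacant_length (Suc T) a b \<omega> \<le> vacant_length T a b \<omega>"
proof -
  show "0 \<le> vacant_length T a b \<omega>"
    unfolding measure_vacant_from[OF assms, symmetric] by simp
  have "measure lborel (vacant_from {a..b} \<omega> T) \<le> measure lborel {a..b}"
    using fmeasurable_cbox[of a b] by (intro measure_mono_fmeasurable) (auto simp: vacant_from_subset)
  then show "vacant_length T a b \<omega> \<le> b - a"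
    using assms by (simp add: measure_vacant_from)
  have "measure lborel (vacant_from {a..b} \<omega> (Suc T)) \<le> measure lborel (vacant_from {a..b} \<omega> T)"
    using vacant_from_measurable[of "{a..b}" \<omega> "Suc T"]
    by (intro measure_mono_fmeasurable vacant_from_fmeasurable) (simp_all add: park_subset)
  then show "vacant_length (Suc T) a b \<omega> \<le> vacant_length T a b \<omega>"
    by (simp only: measure_vacant_from[OF assms])
qed

section \<open>The normalizing constant\<close>

lemma Z_integrable:
  assumes "ldf \<nu>" "0 \<le> L"
  shows "set_integrable lebesgue {0..L} \<nu>"
  using assms by (auto simp: ldf_def)

lemma Z_nonneg: "ldf \<nu> \<Longrightarrow> 0 \<le> Z \<nu> L"
  unfolding Z_def set_lebesgue_integral_def
  by (rule integral_nonneg_AE) (auto simp: ldf_def indicator_def)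

lemma Z_mono:
  assumes "ldf \<nu>" "L \<le> M"
  shows "Z \<nu> L \<le> Z \<nu> M"
proof (cases "0 \<le> L")
  case True
  then show ?thesis
    unfolding Z_def set_lebesgue_integral_def
    using assms Z_integrable[OF assms(1), of L] Z_integrable[OF assms(1), of M]
    unfolding set_integrable_def
    by (intro integral_mono) (auto simp: ldf_def indicator_def)
next
  case False
  then show ?thesis
    using Z_nonneg[OF assms(1), of M] by (simp add: Z_def set_lebesgue_integral_def)
qed

lemma Z_measurable [measurable]: "ldf \<nu> \<Longrightarrow> Z \<nu> \<in> borel_measurable borel"
  by (rule borel_measurable_mono) (auto simp: mono_def Z_mono)

lemma Z_eq_from_1:
  assumes "ldf \<nu>"
  shows "Z \<nu> L = (LINT t:{1..L}|lebesgue. \<nu> t)"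
  unfolding Z_def set_lebesgue_integral_def
  using assms by (intro Bochner_Integration.integral_cong) (auto simp: ldf_def indicator_def)

lemma Z_eq_0:
  assumes "ldf \<nu>" "L \<le> 1"
  shows "Z \<nu> L = 0"
proof -
  \<comment> \<open>For \<open>L = 1\<close> the domain \<open>{1..L}\<close> is the point 1, where
    \<open>\<nu>\<close> may be positive, so this null set is discarded.\<close>
  have "AE x in lebesgue. x \<noteq> (1::real)"
    by (intro AE_completion AE_lborel_singleton)
  then have "AE x in lebesgue. indicator {1..L} x *\<^sub>R \<nu> x = 0"
    by eventually_elim (use assms(2) in \<open>auto simp: indicator_def\<close>)
  then show ?thesis
    unfolding Z_eq_from_1[OF assms(1)] set_lebesgue_integral_def by (rule integral_eq_zero_AE)
qed

lemma Z_pos: "ldf \<nu> \<Longrightarrow> 1 < L \<Longrightarrow> 0 < Z \<nu> L"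
  by (simp add: Z_eq_from_1 ldf_def)

section \<open>Substitutions and measurability\<close>

lemma lborel_integral_translate:
  fixes f :: "real \<Rightarrow> real"
  shows "(LINT x|lborel. f x) = (LINT x|lborel. f (t + x))"
  using lborel_integral_real_affine[where c=1 and f=f and t=t] by simp

lemma lborel_integral_reflect:
  fixes f :: "real \<Rightarrow> real"
  shows "(LINT x|lborel. f x) = (LINT x|lborel. f (t - x))"
  using lborel_integral_real_affine[where c="-1" and f=f and t=t] by simp

text \<open>Lengths carry the Lebesgue sigma-algebra, because their law is a density over
  \<open>lebesgue\<close>; it contains the Borel sets.\<close>

lemma snd_measurable_borel_lebesgue: "snd \<in> borel \<Otimes>\<^sub>M lebesgue \<rightarrow>\<^sub>M (borel :: real measure)"
proof -
  have "(\<lambda>x::real. x) \<in> lebesgue \<rightarrow>\<^sub>M borel"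
    by (rule measurable_completion) simp
  then show ?thesis
    by (rule measurable_compose[OF measurable_snd])
qed

text \<open>The endpoints vary along with the attempts because the recursion replaces them by
  functions of the first attempt; the induction hypothesis has to cover such random
  endpoints.\<close>

lemma vacant_length_measurable:
  assumes "f \<in> borel_measurable N" "g \<in> borel_measurable N"
    and "h \<in> N \<rightarrow>\<^sub>M (\<Pi>\<^sub>M i\<in>UNIV. borel \<Otimes>\<^sub>M lebesgue)"
  shows "(\<lambda>x. vacant_length T (f x) (g x) (h x)) \<in> borel_measurable N"
  using assms
proof (induction T arbitrary: f g h)
  case (Suc T)
  note [measurable] = Suc.prems
  have h: "(\<lambda>x. h x i) \<in> N \<rightarrow>\<^sub>M borel \<Otimes>\<^sub>M lebesgue" for i
    by measurable
  have [measurable]: "(\<lambda>x. fst (h x 0)) \<in> borel_measurable N"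
    using h by measurable
  have [measurable]: "(\<lambda>x. snd (h x 0)) \<in> borel_measurable N"
    by (rule measurable_compose[OF h snd_measurable_borel_lebesgue])
  have [measurable]: "(\<lambda>x i. h x (Suc i)) \<in> N \<rightarrow>\<^sub>M (\<Pi>\<^sub>M i\<in>UNIV. borel \<Otimes>\<^sub>M lebesgue)"
    by (intro measurable_abs_UNIV h)
  note [measurable] = Suc.IH
  show ?case by simp
qed simp

section \<open>The probability space of the process\<close>

locale rsa =
  fixes \<nu> :: "real \<Rightarrow> real" and L :: real
  assumes ldf: "ldf \<nu>" and L_gt_1: "1 < L"
begin

lemma ZL_pos: "0 < Z \<nu> L"
  using Z_pos[OF ldf L_gt_1] .

lemma density_integrable: "integrable lebesgue (\<lambda>l. indicator {1..L} l * (\<nu> l / Z \<nu> L))"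
proof -
  have "set_integrable lebesgue {1..L} \<nu>"
    using ldf L_gt_1 by (auto simp: ldf_def)
  then show ?thesis
    by (auto simp: set_integrable_def dest: integrable_divide[of _ _ "Z \<nu> L"])
qed

lemma density_nonneg: "0 \<le> indicator {1..L} l * (\<nu> l / Z \<nu> L)"
  using ldf ZL_pos by (auto simp: ldf_def indicator_def)

sublocale length: prob_space "length_law \<nu> L"
proof
  have "(\<integral>l. indicator {1..L} l * (\<nu> l / Z \<nu> L) \<partial>lebesgue) = (\<integral>l. indicator {1..L} l *\<^sub>R \<nu> l \<partial>lebesgue) / Z \<nu> L"
    by simp
  also have "\<dots> = Z \<nu> L / Z \<nu> L"
    unfolding Z_eq_from_1[OF ldf, of L] set_lebesgue_integral_def ..
  also have "\<dots> = 1"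
    using ZL_pos by simp
  finally have "(\<integral>\<^sup>+l. ennreal (indicator {1..L} l * (\<nu> l / Z \<nu> L)) \<partial>lebesgue) = 1"
    using nn_integral_eq_integral[OF density_integrable] density_nonneg by simp
  moreover have "(\<lambda>l. ennreal (indicator {1..L} l * (\<nu> l / Z \<nu> L))) \<in> borel_measurable lebesgue"
    using density_integrable by measurable
  ultimately show "emeasure (length_law \<nu> L) (space (length_law \<nu> L)) = 1"
    unfolding length_law_def by (simp add: emeasure_density)
qed

sublocale unif: prob_space "uniform_measure lborel {0..L}"
  using L_gt_1 by (intro prob_space_uniform_measure) auto

sublocale attempt: pair_prob_space "uniform_measure lborel {0..L}" "length_law \<nu> L" ..

sublocale attempt': prob_space "attempt_law \<nu> L"
  unfolding attempt_law_def by unfold_locales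

sublocale seq: sequence_space "attempt_law \<nu> L" ..

lemma sets_length_law: "sets (length_law \<nu> L) = sets lebesgue"
  by (simp add: length_law_def)

lemma sets_attempt_law: "sets (attempt_law \<nu> L) = sets (borel \<Otimes>\<^sub>M lebesgue)"
  unfolding attempt_law_def by (intro sets_pair_measure_cong) (auto simp: sets_length_law)

lemma sets_rsa_law: "sets (rsa_law \<nu> L) = sets (\<Pi>\<^sub>M i\<in>UNIV. borel \<Otimes>\<^sub>M lebesgue)"
  unfolding rsa_law_def by (intro sets_PiM_cong) (auto simp: sets_attempt_law)

sublocale process: prob_space "rsa_law \<nu> L"
  unfolding rsa_law_def by unfold_locales

lemma fst_attempt_measurable [measurable]: "fst \<in> borel_measurable (attempt_law \<nu> L)"
  unfolding measurable_cong_sets[OF sets_attempt_law refl] by simp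

lemma snd_attempt_measurable [measurable]: "snd \<in> borel_measurable (attempt_law \<nu> L)"
  unfolding measurable_cong_sets[OF sets_attempt_law refl]
  by (rule snd_measurable_borel_lebesgue)

lemma vacant_length_measurable_rsa [measurable (raw)]:
  assumes "f \<in> borel_measurable N" "g \<in> borel_measurable N" "h \<in> N \<rightarrow>\<^sub>M rsa_law \<nu> L"
  shows "(\<lambda>x. vacant_length T (f x) (g x) (h x)) \<in> borel_measurable N"
  using assms measurable_cong_sets[OF refl sets_rsa_law, of N]
  by (intro vacant_length_measurable) auto

section \<open>Expected vacant length of a watched interval\<close>

definition mean_vacant :: "nat \<Rightarrow> real \<Rightarrow> real \<Rightarrow> real" where
  "mean_vacant T a b = (LINT \<omega>|rsa_law \<nu> L. vacant_length T a b \<omega>)"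

lemma mean_vacant_measurable [measurable (raw)]:
  assumes [measurable]: "f \<in> borel_measurable N" "g \<in> borel_measurable N"
  shows "(\<lambda>x. mean_vacant T (f x) (g x)) \<in> borel_measurable N"
  unfolding mean_vacant_def by measurable

lemma vacant_length_integrable:
  assumes "a \<le> b"
  shows "integrable (rsa_law \<nu> L) (vacant_length T a b)"
  using vacant_length_bounds[OF assms]
  by (intro process.integrable_const_bound[of _ "b - a"]) auto

lemma mean_vacant_bounds:
  assumes "a \<le> b"
  shows "0 \<le> mean_vacant T a b" "mean_vacant T a b \<le> b - a"
    "mean_vacant (Suc T) a b \<le> mean_vacant T a b"
proof -
  show "0 \<le> mean_vacant T a b"
    unfolding mean_vacant_def using vacant_length_bounds[OF assms] by (intro Bochner_Integration.integral_nonneg) auto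
  show "mean_vacant T a b \<le> b - a"
    unfolding mean_vacant_def
    using vacant_length_bounds[OF assms] vacant_length_integrable[OF assms]
    by (intro process.integral_le_const) auto
  show "mean_vacant (Suc T) a b \<le> mean_vacant T a b"
    unfolding mean_vacant_def
    using vacant_length_bounds(3)[OF assms] vacant_length_integrable[OF assms]
    by (intro integral_mono) auto
qed

definition fits :: "real \<Rightarrow> real \<Rightarrow> real \<times> real \<Rightarrow> bool" where
  "fits a b p \<longleftrightarrow> 0 < snd p \<and> a \<le> fst p \<and> fst p + snd p \<le> b"

lemma fits_measurable [measurable]: "Measurable.pred (attempt_law \<nu> L) (fits a b)"
  unfolding fits_def by measurable

text \<open>Condition on the first attempt: the later attempts are independent of it and have the
  same joint law as the whole sequence. The two gaps keep their positions here; translation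
  invariance comes later.\<close>

lemma mean_vacant_Suc:
  assumes "a \<le> b"
  shows "mean_vacant (Suc T) a b =
    (LINT p|attempt_law \<nu> L. (if fits a b p
      then mean_vacant T a (fst p) + mean_vacant T (fst p + snd p) b else mean_vacant T a b))"
proof -
  let ?A = "attempt_law \<nu> L" and ?R = "rsa_law \<nu> L"
  interpret AR: pair_prob_space ?A ?R ..
  have cn: "(\<lambda>(p, \<omega>). case_nat p \<omega>) \<in> ?A \<Otimes>\<^sub>M ?R \<rightarrow>\<^sub>M ?R"
    unfolding rsa_law_def by measurable
  \<comment> \<open>Prepending an independent attempt preserves the product law
    (\<open>PiM_iter\<close>).\<close>
  have "mean_vacant (Suc T) a b = (LINT \<omega>|distr (?A \<Otimes>\<^sub>M ?R) ?R (\<lambda>(p, \<omega>). case_nat p \<omega>). vacant_length (Suc T) a b \<omega>)"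
    unfolding mean_vacant_def using seq.PiM_iter
    by (simp add: rsa_law_def del: vacant_length.simps)
  also have "\<dots> = (LINT q|(?A \<Otimes>\<^sub>M ?R). vacant_length (Suc T) a b (case q of (p, \<omega>) \<Rightarrow> case_nat p \<omega>))"
    by (intro integral_distr cn) measurable
  also have "\<dots> = (LINT p|?A. LINT \<omega>|?R. vacant_length (Suc T) a b (case_nat p \<omega>))"
  proof (subst AR.integral_fst'[symmetric])
    show "integrable (?A \<Otimes>\<^sub>M ?R) (\<lambda>q. vacant_length (Suc T) a b (case q of (p, \<omega>) \<Rightarrow> case_nat p \<omega>))"
    proof (rule AR.P.integrable_const_bound[of _ "b - a"])
      show "AE q in ?A \<Otimes>\<^sub>M ?R. norm (vacant_length (Suc T) a b (case q of (p, \<omega>) \<Rightarrow> case_nat p \<omega>)) \<le> b - a"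
        using vacant_length_bounds(1,2)[OF assms, of "Suc T"] by (auto simp del: vacant_length.simps)
      show "(\<lambda>q. vacant_length (Suc T) a b (case q of (p, \<omega>) \<Rightarrow> case_nat p \<omega>)) \<in> borel_measurable (?A \<Otimes>\<^sub>M ?R)"
        by (intro vacant_length_measurable_rsa cn) auto
    qed
  qed simp
  also have "\<dots> = (LINT p|?A. (if fits a b p
      then mean_vacant T a (fst p) + mean_vacant T (fst p + snd p) b else mean_vacant T a b))"
  proof (rule Bochner_Integration.integral_cong[OF refl])
    fix p
    show "(LINT \<omega>|?R. vacant_length (Suc T) a b (case_nat p \<omega>)) =
      (if fits a b p then mean_vacant T a (fst p) + mean_vacant T (fst p + snd p) b else mean_vacant T a b)"
      by (auto simp: fits_def mean_vacant_def vacant_length_integrable)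
  qed
  finally show ?thesis .
qed

section \<open>Integrals over one attempt and the recursion\<close>

lemma integral_unif:
  assumes [measurable]: "f \<in> borel_measurable borel"
  shows "(LINT s|uniform_measure lborel {0..L}. f s) = (LINT s:{0..L}|lborel. f s) / L"
proof -
  have "(LINT s|uniform_measure lborel {0..L}. f s) = (LINT s|density lborel (\<lambda>s. ennreal (indicator {0..L} s / L)). f s)"
    using L_gt_1 unfolding uniform_measure_def
    by (intro arg_cong2[where f="integral\<^sup>L"] density_cong)
      (auto simp: indicator_def divide_ennreal[symmetric])
  also have "\<dots> = (LINT s|lborel. (indicator {0..L} s / L) *\<^sub>R f s)"
    using L_gt_1 by (intro integral_density) auto
  finally show ?thesis
    by (simp add: set_lebesgue_integral_def)
qed

lemma integral_length:
  assumes "f \<in> borel_measurable borel"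
  shows "(LINT l|length_law \<nu> L. f l) = (LINT l:{1..L}|lebesgue. \<nu> l * f l) / Z \<nu> L"
proof -
  have "f \<in> borel_measurable lebesgue" using assms by (simp add: measurable_completion)
  then have "(LINT l|length_law \<nu> L. f l) = (LINT l|lebesgue. (indicator {1..L} l * (\<nu> l / Z \<nu> L)) *\<^sub>R f l)"
    unfolding length_law_def
    using density_integrable density_nonneg by (intro integral_density) auto
  then show ?thesis
    by (simp add: set_lebesgue_integral_def ac_simps)
qed

lemma fits_integrable:
  fixes f :: "real \<times> real \<Rightarrow> real"
  assumes "f \<in> borel_measurable (attempt_law \<nu> L)"
    and "\<And>p. fits a b p \<Longrightarrow> \<bar>f p\<bar> \<le> C" and "0 \<le> C"
  shows "integrable (attempt_law \<nu> L) (\<lambda>p. of_bool (fits a b p) * f p)"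
  using assms by (intro attempt'.integrable_const_bound[of _ C]) auto

text \<open>Integrate over the length first: for a left end \<open>s\<close> in
  \<open>[a, b]\<close> the fitting lengths are those up to \<open>b - s\<close>, of probability
  \<open>Z \<nu> (b - s) / Z \<nu> L\<close>. The uniform law of \<open>s\<close> contributes the
  factor \<open>1 / L\<close>.\<close>

lemma integral_fits:
  assumes ab: "0 \<le> a" "b \<le> L" and [measurable]: "\<phi> \<in> borel_measurable borel"
    and C: "\<And>s. a \<le> s \<Longrightarrow> s \<le> b \<Longrightarrow> \<bar>\<phi> s\<bar> \<le> C" "0 \<le> C"
  shows "(LINT p|attempt_law \<nu> L. of_bool (fits a b p) * \<phi> (fst p)) =
    (LINT s:{a..b}|lborel. \<phi> s * Z \<nu> (b - s)) / (L * Z \<nu> L)"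
proof -
  have int: "integrable (attempt_law \<nu> L) (\<lambda>p. of_bool (fits a b p) * \<phi> (fst p))"
    by (rule fits_integrable[of _ _ _ C]) (use C in \<open>auto simp: fits_def\<close>)
  have inner: "(LINT l|length_law \<nu> L. of_bool (fits a b (s, l)) * \<phi> s) =
      indicator {a..b} s * (\<phi> s * Z \<nu> (b - s) / Z \<nu> L)" for s
  proof -
    \<comment> \<open>Since \<open>0 \<le> a\<close> and \<open>b \<le> L\<close>, the cutoff at
      \<open>L\<close> is implied by \<open>l \<le> b - s\<close> for \<open>s\<close> in
      \<open>[a, b]\<close>.\<close>
    have "(LINT l:{1..L}|lebesgue. \<nu> l * (of_bool (fits a b (s, l)) * \<phi> s)) =
        (LINT l|lebesgue. (indicator {a..b} s * \<phi> s) * (indicator {1..b - s} l *\<^sub>R \<nu> l))"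
      unfolding set_lebesgue_integral_def using ab
      by (intro Bochner_Integration.integral_cong) (auto simp: fits_def indicator_def)
    also have "\<dots> = (indicator {a..b} s * \<phi> s) * Z \<nu> (b - s)"
      unfolding Z_eq_from_1[OF ldf] set_lebesgue_integral_def by simp
    finally show ?thesis
      by (subst integral_length) (auto simp: fits_def)
  qed
  have "(LINT p|attempt_law \<nu> L. of_bool (fits a b p) * \<phi> (fst p)) =
      (LINT s|uniform_measure lborel {0..L}. LINT l|length_law \<nu> L. of_bool (fits a b (s, l)) * \<phi> s)"
    using attempt.integral_fst'[of "\<lambda>p. of_bool (fits a b p) * \<phi> (fst p)"] int
    by (simp add: attempt_law_def)
  also have "\<dots> = (LINT s:{0..L}|lborel. indicator {a..b} s * (\<phi> s * Z \<nu> (b - s) / Z \<nu> L)) / L"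
    unfolding inner using ldf by (intro integral_unif) measurable
  also have "(LINT s:{0..L}|lborel. indicator {a..b} s * (\<phi> s * Z \<nu> (b - s) / Z \<nu> L)) =
      (LINT s|lborel. (indicator {a..b} s *\<^sub>R (\<phi> s * Z \<nu> (b - s))) / Z \<nu> L)"
    unfolding set_lebesgue_integral_def using ab
    by (intro Bochner_Integration.integral_cong) (auto simp: indicator_def)
  finally show ?thesis
    by (simp add: set_lebesgue_integral_def mult.commute)
qed

text \<open>
  Reflecting the interval exchanges the lengths of the two remaining gaps; this is the source of
  the factor 2.
\<close>

lemma integral_fits_reflect:
  fixes \<phi> :: "real \<Rightarrow> real"
  assumes ab: "0 \<le> a" "b \<le> L" and [measurable]: "\<phi> \<in> borel_measurable borel"
    and C: "\<And>s. a \<le> s \<Longrightarrow> s \<le> b \<Longrightarrow> \<bar>\<phi> s\<bar> \<le> C" "0 \<le> C"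
  shows "(LINT p|attempt_law \<nu> L. of_bool (fits a b p) * \<phi> (a + b - fst p - snd p)) =
    (LINT p|attempt_law \<nu> L. of_bool (fits a b p) * \<phi> (fst p))"
proof -
  \<comment> \<open>The reflection depends on the length, so the left end is integrated first, with
    the length held fixed.\<close>
  have snd_first: "(LINT p|attempt_law \<nu> L. of_bool (fits a b p) * f p) =
      (LINT l|length_law \<nu> L. LINT s|uniform_measure lborel {0..L}. of_bool (fits a b (s, l)) * f (s, l))"
    if "integrable (attempt_law \<nu> L) (\<lambda>p. of_bool (fits a b p) * f p)" for f :: "real \<times> real \<Rightarrow> real"
    using attempt.integral_snd[of "\<lambda>s l. of_bool (fits a b (s, l)) * f (s, l)"] that
    by (simp add: attempt_law_def case_prod_beta')
  have inner: "(LINT s|uniform_measure lborel {0..L}. of_bool (fits a b (s, l)) * \<phi> (a + b - s - l)) =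
      (LINT s|uniform_measure lborel {0..L}. of_bool (fits a b (s, l)) * \<phi> s)" for l
  proof -
    \<comment> \<open>The map \<open>s \<mapsto> a + b - l - s\<close> preserves the set
      \<open>[a, b - l]\<close> of fitting left ends, which lies inside
      \<open>[0, L]\<close>.\<close>
    have "(LINT s:{0..L}|lborel. of_bool (fits a b (s, l)) * \<phi> s) =
        (LINT s|lborel. indicator {0..L} (a + b - l - s) *\<^sub>R (of_bool (fits a b (a + b - l - s, l)) * \<phi> (a + b - l - s)))"
      unfolding set_lebesgue_integral_def by (rule lborel_integral_reflect)
    also have "\<dots> = (LINT s:{0..L}|lborel. of_bool (fits a b (s, l)) * \<phi> (a + b - s - l))"
      unfolding set_lebesgue_integral_def using ab
      by (intro Bochner_Integration.integral_cong) (auto simp: fits_def indicator_def algebra_simps)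
    finally show ?thesis
      by (subst (1 2) integral_unif) (auto simp: fits_def)
  qed
  have "integrable (attempt_law \<nu> L) (\<lambda>p. of_bool (fits a b p) * \<phi> (a + b - fst p - snd p))"
    by (rule fits_integrable[of _ _ _ C]) (use C in \<open>auto simp: fits_def\<close>)
  moreover have "integrable (attempt_law \<nu> L) (\<lambda>p. of_bool (fits a b p) * \<phi> (fst p))"
    by (rule fits_integrable[of _ _ _ C]) (use C in \<open>auto simp: fits_def\<close>)
  ultimately show ?thesis
    by (simp add: snd_first inner)
qed

text \<open>A fitting attempt trades the value of \<open>[a, b]\<close> for the values of its two
  gaps. The premise \<open>shift\<close> is translation invariance at stage \<open>T\<close>; the
  resulting formula involves only \<open>b - a\<close>, so the invariance passes to stage
  \<open>T + 1\<close>.\<close>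

lemma mean_vacant_step:
  assumes ab: "0 \<le> a" "a \<le> b" "b \<le> L"
    and shift: "\<And>c d. 0 \<le> c \<Longrightarrow> c \<le> d \<Longrightarrow> d \<le> L \<Longrightarrow> mean_vacant T c d = mean_vacant T 0 (d - c)"
  shows "mean_vacant (Suc T) a b = mean_vacant T 0 (b - a) +
    (2 * (LINT s:{0..b - a}|lborel. mean_vacant T 0 s * Z \<nu> (b - a - s)) -
      (LINT s:{0..b - a}|lborel. Z \<nu> s) * mean_vacant T 0 (b - a)) / (L * Z \<nu> L)"
proof -
  let ?A = "attempt_law \<nu> L" and ?M = "L * Z \<nu> L"
  define \<phi> where "\<phi> s = mean_vacant T 0 (s - a)" for s
  have [measurable]: "\<phi> \<in> borel_measurable borel"
    unfolding \<phi>_def by measurable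
  have \<phi>_bound: "\<bar>\<phi> s\<bar> \<le> L" if "a \<le> s" "s \<le> b" for s
    using mean_vacant_bounds[of 0 "s - a" T] that ab by (auto simp: \<phi>_def)
  let ?f = "\<lambda>p. of_bool (fits a b p) * \<phi> (fst p)"
    and ?g = "\<lambda>p. of_bool (fits a b p) * \<phi> (a + b - fst p - snd p)"
    and ?h = "\<lambda>p. of_bool (fits a b p) * (1::real)"
  have int: "integrable ?A ?f" "integrable ?A ?g" "integrable ?A ?h"
    by (rule fits_integrable[where C=L]; use \<phi>_bound L_gt_1 in \<open>auto simp: fits_def\<close>)+
  \<comment> \<open>The integrand becomes the old value plus a correction supported on fitting
    attempts.\<close>
  have "mean_vacant (Suc T) a b = (LINT p|?A. mean_vacant T 0 (b - a) + (?f p + ?g p - mean_vacant T 0 (b - a) * ?h p))"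
    unfolding mean_vacant_Suc[OF ab(2)]
  proof (rule Bochner_Integration.integral_cong[OF refl])
    fix p :: "real \<times> real"
    show "(if fits a b p then mean_vacant T a (fst p) + mean_vacant T (fst p + snd p) b else mean_vacant T a b) =
        mean_vacant T 0 (b - a) + (?f p + ?g p - mean_vacant T 0 (b - a) * ?h p)"
    proof (cases "fits a b p")
      case True
      then have "mean_vacant T a (fst p) = mean_vacant T 0 (fst p - a)"
        "mean_vacant T (fst p + snd p) b = mean_vacant T 0 (b - (fst p + snd p))"
        using ab by (auto simp: fits_def intro!: shift)
      then show ?thesis using True by (simp add: \<phi>_def algebra_simps)
    next
      case False
      then show ?thesis using shift[OF ab] by simp
    qed
  qed
  also have "\<dots> = mean_vacant T 0 (b - a) + ((LINT p|?A. ?f p) + (LINT p|?A. ?g p) - mean_vacant T 0 (b - a) * (LINT p|?A. ?h p))"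
    using int by (simp add: attempt'.prob_space del: mult_1_right)
  also have "(LINT p|?A. ?g p) = (LINT p|?A. ?f p)"
    using \<phi>_bound ab L_gt_1 by (intro integral_fits_reflect[where C=L]) auto
  also have "(LINT p|?A. ?f p) = (LINT s:{a..b}|lborel. \<phi> s * Z \<nu> (b - s)) / ?M"
    using \<phi>_bound ab L_gt_1 by (intro integral_fits[where C=L]) auto
  also have "(LINT p|?A. ?h p) = (LINT s:{a..b}|lborel. 1 * Z \<nu> (b - s)) / ?M"
    using ab by (intro integral_fits[where C=1]) auto
  also have "(LINT s:{a..b}|lborel. \<phi> s * Z \<nu> (b - s)) = (LINT s:{0..b - a}|lborel. mean_vacant T 0 s * Z \<nu> (b - a - s))"
    unfolding set_lebesgue_integral_def
    by (subst lborel_integral_translate[of _ a])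
      (auto intro!: Bochner_Integration.integral_cong simp: \<phi>_def indicator_def algebra_simps)
  also have "(LINT s:{a..b}|lborel. 1 * Z \<nu> (b - s)) = (LINT s:{0..b - a}|lborel. Z \<nu> s)"
    unfolding set_lebesgue_integral_def
    by (subst lborel_integral_reflect[of _ b])
      (auto intro!: Bochner_Integration.integral_cong simp: indicator_def)
  also have "m + (q / ?M + q / ?M - m * (w / ?M)) = m + (2 * q - w * m) / ?M" for m q w :: real
    by (simp add: diff_divide_distrib)
  finally show ?thesis .
qed

lemma mean_vacant_shift:
  assumes "0 \<le> a" "a \<le> b" "b \<le> L"
  shows "mean_vacant T a b = mean_vacant T 0 (b - a)"
  using assms
proof (induction T arbitrary: a b)
  case 0
  then show ?case by (simp add: mean_vacant_def)
next
  case (Suc T)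
  show ?case
    using mean_vacant_step[OF Suc.prems Suc.IH] mean_vacant_step[OF _ _ _ Suc.IH, of 0 "b - a"] Suc.prems
    by simp
qed

lemma mean_vacant_recursion:
  assumes "0 \<le> x" "x \<le> L"
  shows "mean_vacant (Suc T) 0 x = mean_vacant T 0 x +
    (2 * (LINT s:{0..x}|lborel. mean_vacant T 0 s * Z \<nu> (x - s)) -
      (LINT s:{0..x}|lborel. Z \<nu> s) * mean_vacant T 0 x) / (L * Z \<nu> L)"
  using mean_vacant_step[OF _ assms mean_vacant_shift] by simp

section \<open>The limit of infinitely many attempts\<close>

definition limit_vacant :: "real \<Rightarrow> real" where
  "limit_vacant x = lim (\<lambda>T. mean_vacant T 0 x)"

lemma limit_vacant_measurable [measurable]: "limit_vacant \<in> borel_measurable borel"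
  unfolding limit_vacant_def by measurable

lemma mean_vacant_tendsto:
  assumes "0 \<le> x"
  shows "(\<lambda>T. mean_vacant T 0 x) \<longlonglongrightarrow> limit_vacant x"
proof -
  have "decseq (\<lambda>T. mean_vacant T 0 x)"
    using mean_vacant_bounds(3)[OF assms] by (simp add: decseq_Suc_iff)
  then obtain l where "(\<lambda>T. mean_vacant T 0 x) \<longlonglongrightarrow> l"
    using mean_vacant_bounds(1)[OF assms] decseq_convergent by metis
  then show ?thesis
    using limI by (fastforce simp: limit_vacant_def)
qed

text \<open>The increments of a convergent sequence tend to 0, and by the recursion they tend to the
  difference of the two sides divided by \<open>L * Z \<nu> L\<close>.\<close>

lemma limit_vacant_balance:
  assumes x: "0 \<le> x" "x \<le> L"
  shows "(LINT s:{0..x}|lborel. Z \<nu> s) * limit_vacant x =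
    2 * (LINT s:{0..x}|lborel. limit_vacant s * Z \<nu> (x - s))"
proof -
  note [measurable] = Z_measurable[OF ldf]
  define W where "W = (LINT s:{0..x}|lborel. Z \<nu> s)"
  define K where "K f = (LINT s:{0..x}|lborel. f s * Z \<nu> (x - s))" for f
  have K: "(\<lambda>T. K (mean_vacant T 0)) \<longlonglongrightarrow> K limit_vacant"
    unfolding K_def set_lebesgue_integral_def
  proof (rule integral_dominated_convergence)
    \<comment> \<open>The dominating constant comes from
      \<open>mean_vacant T 0 s \<le> s \<le> x\<close> and the monotonicity of
      \<open>Z\<close>.\<close>
    show "integrable lborel (\<lambda>s. indicator {0..x} s *\<^sub>R (x * Z \<nu> x))"
      by (simp add: integrable_indicator_iff emeasure_lborel_Icc_eq)
    show "AE s in lborel. (\<lambda>T. indicator {0..x} s *\<^sub>R (mean_vacant T 0 s * Z \<nu> (x - s)))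
        \<longlonglongrightarrow> indicator {0..x} s *\<^sub>R (limit_vacant s * Z \<nu> (x - s))"
      by (intro AE_I2) (auto simp: indicator_def intro!: tendsto_intros mean_vacant_tendsto)
    show "AE s in lborel. norm (indicator {0..x} s *\<^sub>R (mean_vacant T 0 s * Z \<nu> (x - s))) \<le> indicator {0..x} s *\<^sub>R (x * Z \<nu> x)" for T
    proof (rule AE_I2)
      fix s :: real
      have "\<bar>mean_vacant T 0 s * Z \<nu> (x - s)\<bar> \<le> x * Z \<nu> x" if "0 \<le> s" "s \<le> x"
        unfolding abs_mult
        using mean_vacant_bounds(1,2)[of 0 s T] Z_mono[OF ldf, of "x - s" x] Z_nonneg[OF ldf, of "x - s"] that
        by (intro mult_mono) auto
      then show "norm (indicator {0..x} s *\<^sub>R (mean_vacant T 0 s * Z \<nu> (x - s))) \<le> indicator {0..x} s *\<^sub>R (x * Z \<nu> x)"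
        by (auto simp: indicator_def)
    qed
  qed measurable
  have "(\<lambda>T. mean_vacant (Suc T) 0 x) \<longlonglongrightarrow>
      limit_vacant x + (2 * K limit_vacant - W * limit_vacant x) / (L * Z \<nu> L)"
    unfolding mean_vacant_recursion[OF x] W_def[symmetric] K_def[symmetric]
    using L_gt_1 ZL_pos by (intro tendsto_intros mean_vacant_tendsto x K) auto
  moreover have "(\<lambda>T. mean_vacant (Suc T) 0 x) \<longlonglongrightarrow> limit_vacant x"
    using mean_vacant_tendsto[OF x(1)] by (rule LIMSEQ_Suc)
  ultimately have "(2 * K limit_vacant - W * limit_vacant x) / (L * Z \<nu> L) = 0"
    using LIMSEQ_unique by fastforce
  then show ?thesis
    using L_gt_1 ZL_pos unfolding W_def K_def by auto
qed

text \<open>Both integrals in the recursion vanish with \<open>Z\<close> on \<open>[0, 1]\<close>,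
  so the sequence is constant.\<close>

lemma limit_vacant_small:
  assumes "0 \<le> x" "x \<le> 1"
  shows "limit_vacant x = x"
proof -
  have zero: "(LINT s:{0..x}|lborel. f s * Z \<nu> (x - s)) = 0" "(LINT s:{0..x}|lborel. Z \<nu> s) = 0" for f
    unfolding set_lebesgue_integral_def using assms
    by (intro integral_eq_zero_AE; force simp: indicator_def Z_eq_0[OF ldf])+
  have "mean_vacant T 0 x = x" for T
  proof (induction T)
    case 0
    then show ?case by (simp add: mean_vacant_def process.prob_space)
  next
    case (Suc T)
    then show ?case using mean_vacant_recursion[of x T] assms L_gt_1 by (simp add: zero)
  qed
  then show ?thesis by (simp add: limit_vacant_def)
qed

text \<open>Dominated convergence with the bound \<open>L\<close> exchanges the limit in
  \<open>T\<close> with the expectation.\<close>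

lemma expected_empty_space_eq: "expected_empty_space \<nu> L = limit_vacant L"
proof -
  have L: "0 \<le> L" using L_gt_1 by simp
  have empty_space: "empty_space L \<omega> = lim (\<lambda>T. vacant_length T 0 L \<omega>)" for \<omega>
    using L by (simp add: empty_space_def vacant_eq_vacant_from measure_vacant_from)
  have conv: "(\<lambda>T. vacant_length T 0 L \<omega>) \<longlonglongrightarrow> empty_space L \<omega>" for \<omega>
  proof -
    have "decseq (\<lambda>T. vacant_length T 0 L \<omega>)"
      by (intro decseq_SucI vacant_length_bounds(3)[OF L])
    then obtain l where "(\<lambda>T. vacant_length T 0 L \<omega>) \<longlonglongrightarrow> l"
      using vacant_length_bounds(1)[OF L] decseq_convergent by metis
    then show ?thesis
      using limI by (fastforce simp: empty_space)
  qed
  have "(\<lambda>T. mean_vacant T 0 L) \<longlonglongrightarrow> (LINT \<omega>|rsa_law \<nu> L. empty_space L \<omega>)"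
    unfolding mean_vacant_def
  proof (rule integral_dominated_convergence)
    show "integrable (rsa_law \<nu> L) (\<lambda>\<omega>. L)"
      by simp
    show "empty_space L \<in> borel_measurable (rsa_law \<nu> L)"
      unfolding empty_space by measurable
    show "AE \<omega> in rsa_law \<nu> L. (\<lambda>T. vacant_length T 0 L \<omega>) \<longlonglongrightarrow> empty_space L \<omega>"
      using conv by simp
    show "AE \<omega> in rsa_law \<nu> L. norm (vacant_length T 0 L \<omega>) \<le> L" for T
      using vacant_length_bounds(1,2)[OF L, of T] by simp
  qed measurable
  then show ?thesis
    using LIMSEQ_unique[OF mean_vacant_tendsto[OF L]] L_gt_1
    by (simp add: expected_empty_space_def)
qed

end

section \<open>Independence of the ambient length and the identity\<close>

lemma integral_Z_pos:
  assumes "ldf \<nu>" "1 < x"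
  shows "0 < (LINT s:{0..x}|lborel. Z \<nu> s)"
proof -
  note [measurable] = Z_measurable[OF assms(1)]
  \<comment> \<open>Any point strictly between 1 and \<open>x\<close> would do: \<open>Z\<close> is
    at least \<open>Z \<nu> m > 0\<close> on \<open>[m, x]\<close>.\<close>
  define m where "m = (1 + x) / 2"
  have m: "1 < m" "m < x" using assms(2) by (auto simp: m_def)
  have "0 < (x - m) * Z \<nu> m"
    using m Z_pos[OF assms(1)] by simp
  also have "\<dots> = (LINT s|lborel. indicator {m..x} s *\<^sub>R Z \<nu> m)"
    using m by simp
  also have "\<dots> \<le> (LINT s:{0..x}|lborel. Z \<nu> s)"
    unfolding set_lebesgue_integral_def
  proof (rule integral_mono)
    show "integrable lborel (\<lambda>s. indicator {0..x} s *\<^sub>R Z \<nu> s)"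
    proof (rule Bochner_Integration.integrable_bound)
      show "integrable lborel (\<lambda>s. indicator {0..x} s *\<^sub>R Z \<nu> x)"
        by (simp add: integrable_indicator_iff emeasure_lborel_Icc_eq)
      show "AE s in lborel. norm (indicator {0..x} s *\<^sub>R Z \<nu> s) \<le> norm (indicator {0..x} s *\<^sub>R Z \<nu> x)"
        using Z_mono[OF assms(1), of _ x] Z_nonneg[OF assms(1)] by (intro AE_I2) (auto simp: indicator_def)
    qed measurable
    show "indicator {m..x} s *\<^sub>R Z \<nu> m \<le> indicator {0..x} s *\<^sub>R Z \<nu> s" for s
      using m Z_mono[OF assms(1), of m s] Z_nonneg[OF assms(1)] by (auto simp: indicator_def)
  qed (simp add: integrable_indicator_iff emeasure_lborel_Icc_eq)
  finally show ?thesis .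
qed

text \<open>The processes on \<open>[0, L]\<close> and \<open>[0, x]\<close> satisfy the same
  balance equation at \<open>x\<close>; once the right sides agree, the positive factor from
  \<open>integral_Z_pos\<close> cancels.\<close>

lemma limit_vacant_eq_expected:
  assumes "ldf \<nu>" "1 < L" "0 \<le> x" "x \<le> L"
  shows "rsa.limit_vacant \<nu> L x = expected_empty_space \<nu> x"
proof -
  \<comment> \<open>\<open>L\<close> is generalized so that the induction hypothesis applies with
    ambient length \<open>L\<close> and with ambient length \<open>x\<close>.\<close>
  have "x \<le> real n \<Longrightarrow> rsa.limit_vacant \<nu> L x = expected_empty_space \<nu> x" for n
    using assms(2-4)
  proof (induction n arbitrary: L x)
    case 0
    then interpret rsa \<nu> L using assms(1) by unfold_locales
    show ?case using 0 limit_vacant_small[of 0] by (simp add: expected_empty_space_def)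
  next
    case (Suc n)
    then interpret L: rsa \<nu> L using assms(1) by unfold_locales
    show ?case
    proof (cases "x \<le> 1")
      case True
      then show ?thesis using L.limit_vacant_small Suc.prems by (simp add: expected_empty_space_def)
    next
      case False
      then interpret x: rsa \<nu> x using assms(1) by unfold_locales auto
      have "(LINT s:{0..x}|lborel. L.limit_vacant s * Z \<nu> (x - s)) =
          (LINT s:{0..x}|lborel. x.limit_vacant s * Z \<nu> (x - s))"
        unfolding set_lebesgue_integral_def
      proof (rule Bochner_Integration.integral_cong[OF refl])
        fix s
        show "indicator {0..x} s *\<^sub>R (L.limit_vacant s * Z \<nu> (x - s)) =
            indicator {0..x} s *\<^sub>R (x.limit_vacant s * Z \<nu> (x - s))"
        \<comment> \<open>Up to \<open>x - 1 \<le> n\<close> the induction hypothesis applies;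
          beyond it \<open>x - s < 1\<close> and \<open>Z\<close> vanishes.\<close>
        proof (cases "0 \<le> s \<and> s \<le> x - 1")
          case True
          then show ?thesis
            using Suc.IH[of s L] Suc.IH[of s x] Suc.prems False by simp
        next
          case False
          then show ?thesis
            using Z_eq_0[OF assms(1), of "x - s"] by (auto simp: indicator_def)
        qed
      qed
      then have "(LINT s:{0..x}|lborel. Z \<nu> s) * L.limit_vacant x = (LINT s:{0..x}|lborel. Z \<nu> s) * x.limit_vacant x"
        using L.limit_vacant_balance[of x] x.limit_vacant_balance[of x] Suc.prems by simp
      then show ?thesis
        using integral_Z_pos[OF assms(1), of x] False x.expected_empty_space_eq by simp
    qed
  qed
  then show ?thesis
    using real_arch_simple by blast
qed

theorem proposition5p2:
  fixes \<nu> :: "real \<Rightarrow> real" and L :: real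
  assumes "ldf \<nu>" and "L \<ge> 0"
  shows "(LINT t:{0..L}|lebesgue. Z \<nu> t) * expected_empty_space \<nu> L =
         2 * (LINT t:{0..L}|lebesgue. expected_empty_space \<nu> t * Z \<nu> (L - t))"
proof (cases "L \<le> 1")
  case True
  have "(LINT t:{0..L}|lebesgue. Z \<nu> t) = 0" "(LINT t:{0..L}|lebesgue. expected_empty_space \<nu> t * Z \<nu> (L - t)) = 0"
    unfolding set_lebesgue_integral_def using True
    by (intro integral_eq_zero_AE; force simp: indicator_def Z_eq_0[OF assms(1)])+
  then show ?thesis by simp
next
  case False
  then interpret rsa \<nu> L using assms(1) by unfold_locales auto
  note [measurable] = Z_measurable[OF assms(1)]
  have "(LINT t:{0..L}|lebesgue. Z \<nu> t) = (LINT t:{0..L}|lborel. Z \<nu> t)"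
    unfolding set_lebesgue_integral_def by (rule integral_completion) measurable
  \<comment> \<open>Replacing \<open>lebesgue\<close> by \<open>lborel\<close> requires a Borel
    measurable integrand, so \<open>limit_vacant\<close> is substituted first.\<close>
  moreover have "(LINT t:{0..L}|lebesgue. expected_empty_space \<nu> t * Z \<nu> (L - t)) =
      (LINT t:{0..L}|lebesgue. limit_vacant t * Z \<nu> (L - t))"
    unfolding set_lebesgue_integral_def using limit_vacant_eq_expected[OF assms(1) L_gt_1]
    by (intro Bochner_Integration.integral_cong) (auto simp: indicator_def)
  moreover have "\<dots> = (LINT t:{0..L}|lborel. limit_vacant t * Z \<nu> (L - t))"
    unfolding set_lebesgue_integral_def by (rule integral_completion) measurable
  ultimately show ?thesis
    using limit_vacant_balance[of L] expected_empty_space_eq assms(2) by simp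
qed

end
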